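(* Let $n,h,b\ge 1$ be integers, let $\mathcal{Y}$ be a finite set of labels, and let $\mathcal{C}:\mathcal{I}_{n,h,b}\to\mathcal{Y}$ be any classifier. Then for every real $c>0$ and every integer $p\ge 0$, no interesting class induced by $\mathcal{C}$ is $2e^{-2c^2}$-robust to $L^p$-perturbations of size $(2+c\sqrt{h}\,n)^{1/\max(p,1)}$.
   Context: For integers $n,h,b\ge1$, $\mathcal{I}_{n,h,b}$ is the finite set of all real tensors of shape $(n,n,h)$ each of whose entries lies in the set of $2^b$ equally spaced values $\{x/(2^b-1): x=0,1,\dots,2^b-1\}\subset[0,1]$ ("images"). For a tensor $A$ and an integer $p\ge1$, $\|A\|_p$ is the $p$th root of the sum of the $p$th powers of the absolute values of the entries of $A$; $\|A\|_0$ is the number of nonzero entries of $A$. A classifier is a function $\mathcal{C}:\mathcal{I}_{n,h,b}\to\mathcal{Y}$ with $\mathcal{Y}$ a finite set; the classes induced by $\mathcal{C}$ are the preimages $\mathcal{C}^{-1}(y)$, $y\in\mathcal{Y}$. A class is interesting if it is nonempty and contains at most half of the elements of $\mathcal{I}_{n,h,b}$. An image $I$ is robust to $L^p$-perturbations of size $d$ if for all $I'\in\mathcal{I}_{n,h,b}$, $\|I-I'\|_p\le d$ implies $\mathcal{C}(I)=\mathcal{C}(I')$. A class $C$ is $r$-robust to $L^p$-perturbations of size $d$ if $C$ is nonempty and the number of images $I\in C$ that are robust to $L^p$-perturbations of size $d$ is at least $r|C|$. *)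

theory Defs
  imports "HOL-Analysis.Analysis"
begin

text \<open>Tensors of shape (n,n,h) are functions on index triples; indices start at 0.\<close>

type_synonym tensor = "nat \<times> nat \<times> nat \<Rightarrow> real"

definition tensor_index :: "nat \<Rightarrow> nat \<Rightarrow> (nat \<times> nat \<times> nat) set" where
  "tensor_index n h = {0..<n} \<times> {0..<n} \<times> {0..<h}"

definition pixel_values :: "nat \<Rightarrow> real set" where
  "pixel_values b = {real x / (2 ^ b - 1) | x :: nat. x \<le> 2 ^ b - 1}"

text \<open>Using the extensional function space, each tensor is represented by exactly one function,
  so that cardinalities of sets of images are the intended ones.\<close>

definition images :: "nat \<Rightarrow> nat \<Rightarrow> nat \<Rightarrow> tensor set" where
  "images n h b = tensor_index n h \<rightarrow>\<^sub>E pixel_values b"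

definition tensor_norm :: "nat \<Rightarrow> nat \<Rightarrow> nat \<Rightarrow> tensor \<Rightarrow> real" where
  "tensor_norm n h p A =
     (if p = 0 then real (card {i \<in> tensor_index n h. A i \<noteq> 0})
      else root p (\<Sum>i\<in>tensor_index n h. \<bar>A i\<bar> ^ p))"

definition induced_class :: "nat \<Rightarrow> nat \<Rightarrow> nat \<Rightarrow> (tensor \<Rightarrow> 'y) \<Rightarrow> 'y \<Rightarrow> tensor set" where
  "induced_class n h b f y = {I \<in> images n h b. f I = y}"

definition interesting :: "nat \<Rightarrow> nat \<Rightarrow> nat \<Rightarrow> tensor set \<Rightarrow> bool" where
  "interesting n h b C \<longleftrightarrow> C \<noteq> {} \<and> real (card C) \<le> real (card (images n h b)) / 2"

definition robust_image ::
    "nat \<Rightarrow> nat \<Rightarrow> nat \<Rightarrow> (tensor \<Rightarrow> 'y) \<Rightarrow> nat \<Rightarrow> real \<Rightarrow> tensor \<Rightarrow> bool" where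
  "robust_image n h b f p d I \<longleftrightarrow>
     (\<forall>I'\<in>images n h b. tensor_norm n h p (\<lambda>i. I i - I' i) \<le> d \<longrightarrow> f I = f I')"

definition robust_class ::
    "nat \<Rightarrow> nat \<Rightarrow> nat \<Rightarrow> (tensor \<Rightarrow> 'y) \<Rightarrow> real \<Rightarrow> nat \<Rightarrow> real \<Rightarrow> tensor set \<Rightarrow> bool" where
  "robust_class n h b f r p d C \<longleftrightarrow>
     C \<noteq> {} \<and> real (card {I \<in> C. robust_image n h b f p d I}) \<ge> r * real (card C)"

lemma pixel_values_image: "pixel_values b = (\<lambda>x. real x / (2 ^ b - 1)) ` {..2 ^ b - 1}"
  by (auto simp: pixel_values_def)

lemma finite_tensor_index: "finite (tensor_index n h)"
  by (simp add: tensor_index_def)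

lemma finite_images: "finite (images n h b)"
  unfolding images_def
  by (intro finite_PiE) (simp_all add: finite_tensor_index pixel_values_image)

lemma card_pixel_values:
  assumes "b \<ge> 1"
  shows "card (pixel_values b) = 2 ^ b"
proof -
  have "(2::real) ^ b > 1"
    using assms by (simp add: one_less_power)
  then have "inj_on (\<lambda>x. real x / (2 ^ b - 1)) {..2 ^ b - 1 :: nat}"
    by (auto simp: inj_on_def)
  then show ?thesis
    by (simp add: pixel_values_image card_image)
qed

lemma card_images:
  assumes "b \<ge> 1"
  shows "card (images n h b) = (2 ^ b) ^ (n * n * h)"
  unfolding images_def
  by (subst card_PiE) (simp_all add: finite_tensor_index card_pixel_values[OF assms] tensor_index_def
      mult.assoc)

end

theory Submission
  imports Defs "HOL-Probability.Characteristic_Functions"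
begin

text \<open>
  Let \<open>Phi\<close> be the standard normal distribution function.  By induction on the number \<open>N\<close>
  of coordinates, a set of density at least \<open>Phi x\<close> in a finite power \<open>V\<^sup>N\<close> has a Hamming
  \<open>t\<close>-neighbourhood of density at least \<open>Phi (x + s)\<close> with \<open>s = 2 (t - 1) / sqrt N + 2 / N\<close>.
  The \<open>t\<close>-neighbourhood of a set contains, in every slice along the last coordinate, both the
  \<open>t\<close>-neighbourhood of the slice and the \<open>(t - 1)\<close>-neighbourhood of the largest slice.  Since
  \<open>Phi u \<mapsto> Phi (u + s)\<close> is concave, averaging over the slices reduces the induction step to
  comparing shifts of a Gaussian with shifts of a mixture of two Gaussians.
  The images robust to perturbations of the given size form a set whose \<open>t\<close>-neighbourhood, for
  \<open>t\<close> the integer part of \<open>2 + c sqrt N\<close>, lies in the class, so the theorem follows from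
  \<open>Phi (y - s) \<le> exp (- s\<^sup>2 / 2) * Phi y\<close> for \<open>y \<le> 0\<close>.
\<close>

section \<open>The standard normal distribution function\<close>

abbreviation Phi :: "real \<Rightarrow> real" where
  "Phi \<equiv> cdf std_normal_distribution"

interpretation std_normal: real_distribution std_normal_distribution
  by (rule real_dist_normal_dist)

lemma Phi_diff:
  assumes "a \<le> b"
  shows "integral {a..b} std_normal_density = Phi b - Phi a"
proof (cases "a = b")
  case False
  then have "a < b" using assms by simp
  have int: "set_integrable lborel {a<..b} std_normal_density"
    unfolding set_integrable_def by (intro integrable_mult_indicator) auto
  have "Phi b - Phi a = measure std_normal_distribution {a<..b}"
    by (rule std_normal.cdf_diff_eq) fact
  also have "\<dots> = (LINT x|std_normal_distribution. indicator {a<..b} x)"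
    by simp
  also have "\<dots> = (LBINT x:{a<..b}. std_normal_density x)"
    unfolding set_lebesgue_integral_def by (subst integral_density) (auto simp: mult.commute)
  also have "\<dots> = integral {a<..b} std_normal_density"
    by (rule set_borel_integral_eq_integral) fact
  also have "\<dots> = integral {a..b} std_normal_density"
    by (rule integral_spike_set; rule negligible_subset[OF negligible_sing[of a]]) force+
  finally show ?thesis ..
qed simp

lemma Phi_deriv: "(Phi has_real_derivative std_normal_density x) (at x)"
proof -
  have "((\<lambda>y. integral {x - 1..y} std_normal_density) has_real_derivative std_normal_density x)
        (at x within {x - 1..x + 1})"
    by (rule integral_has_real_derivative)
       (auto simp: std_normal_density_def intro!: continuous_intros)
  then have "((\<lambda>y. integral {x - 1..y} std_normal_density) has_real_derivative std_normal_density x)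
        (at x)"
    by (simp add: at_within_Icc_at)
  then have "((\<lambda>y. integral {x - 1..y} std_normal_density + Phi (x - 1)) 
      has_real_derivative std_normal_density x + 0) (at x)"
    by (intro derivative_intros)
  moreover have "integral {x - 1..y} std_normal_density + Phi (x - 1) = Phi y"
    if "y \<in> {x - 1<..}" for y
    using Phi_diff[of "x - 1" y] that by simp
  ultimately show ?thesis
    by (subst (asm) DERIV_cong_ev[OF refl _ refl, where g = Phi])
       (auto intro!: eventually_nhds_in_open[of "{x - 1<..}", THEN eventually_mono])
qed

lemma Phi_strict_mono: "strict_mono Phi"
proof (rule strict_monoI)
  fix x y :: real
  assume "x < y"
  then show "Phi x < Phi y"
    by (rule DERIV_pos_imp_increasing) (metis Phi_deriv normal_density_pos zero_less_one)
qed

lemma Phi_less_iff [simp]: "Phi x < Phi y \<longleftrightarrow> x < y"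
  and Phi_le_iff [simp]: "Phi x \<le> Phi y \<longleftrightarrow> x \<le> y"
  and Phi_eq_iff [simp]: "Phi x = Phi y \<longleftrightarrow> x = y"
  using Phi_strict_mono by (simp_all add: strict_mono_less strict_mono_less_eq strict_mono_eq)

lemma Phi_pos: "0 < Phi x" and Phi_less_1: "Phi x < 1"
proof -
  show "0 < Phi x"
    using std_normal.cdf_nonneg[of "x - 1"] Phi_less_iff[of "x - 1" x] by linarith
  show "Phi x < 1"
    using std_normal.cdf_bounded_prob[of "x + 1"] Phi_less_iff[of x "x + 1"] by linarith
qed

lemma isCont_Phi: "isCont Phi x"
  using Phi_deriv by (rule DERIV_isCont)

lemma Phi_surj:
  assumes "0 < a" "a < 1"
  obtains x where "Phi x = a"
proof -
  have "eventually (\<lambda>x. Phi x < a) at_bot"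
    using std_normal.cdf_lim_at_bot assms(1) by (rule order_tendstoD)
  then obtain l where l: "Phi l < a"
    by (auto simp: eventually_at_bot_linorder)
  have "eventually (\<lambda>x. Phi x > a) at_top"
    using std_normal.cdf_lim_at_top_prob assms(2) by (rule order_tendstoD)
  then obtain u where u: "a < Phi u"
    by (auto simp: eventually_at_top_linorder)
  have "l \<le> u"
    using l u by (metis Phi_less_iff less_trans less_imp_le)
  then show ?thesis
    using IVT[of Phi l a u] l u isCont_Phi that by force
qed

text \<open>The difference \<open>g\<close> tends to 0 at minus infinity and does not decrease on
  the negative half-line: shifting the density multiplies it by
  \<open>exp (- s\<^sup>2 / 2) * exp (z * s)\<close>, whose last factor is at most 1 for
  \<open>z \<le> 0\<close>.\<close>

lemma Phi_shift_le:
  assumes "y \<le> 0" "0 \<le> s"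
  shows "Phi (y - s) \<le> exp (- s\<^sup>2 / 2) * Phi y"
proof -
  define g where "g z = exp (- s\<^sup>2 / 2) * Phi z - Phi (z - s)" for z
  have der: "(g has_real_derivative
      (exp (- s\<^sup>2 / 2) * std_normal_density z - std_normal_density (z - s))) (at z)" for z
    unfolding g_def
    by (rule derivative_eq_intros DERIV_chain2[OF Phi_deriv] Phi_deriv refl | simp)+
  have eq: "std_normal_density (z - s) = exp (- s\<^sup>2 / 2) * std_normal_density z * exp (z * s)" for z
    by (simp add: std_normal_density_def mult_exp_exp field_simps power2_eq_square)
  have nn: "0 \<le> exp (- s\<^sup>2 / 2) * std_normal_density z - std_normal_density (z - s)" if "z \<le> 0" for z
  proof -
    have "exp (z * s) \<le> 1"
      using that assms by (simp add: mult_nonpos_nonneg)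
    then show ?thesis
      unfolding eq using mult_left_le[of "exp (z * s)" "exp (- s\<^sup>2 / 2) * std_normal_density z"] by simp
  qed
  have "g z \<le> g y" if "z \<le> y" for z
    using that by (rule DERIV_nonneg_imp_nondecreasing) (use der nn assms in force)
  then have ev: "eventually (\<lambda>z. g z \<le> g y) at_bot"
    by (auto simp: eventually_at_bot_linorder)
  have "filterlim (\<lambda>z::real. z - s) at_bot at_bot"
    unfolding filterlim_at_bot eventually_at_bot_linorder
    by (metis diff_le_eq)
  then have "((\<lambda>z. Phi (z - s)) \<longlongrightarrow> 0) at_bot"
    by (rule filterlim_compose[OF std_normal.cdf_lim_at_bot])
  then have "(g \<longlongrightarrow> exp (- s\<^sup>2 / 2) * 0 - 0) at_bot"
    unfolding g_def by (intro tendsto_intros std_normal.cdf_lim_at_bot)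
  then have "exp (- s\<^sup>2 / 2) * 0 - 0 \<le> g y"
    by (rule tendsto_upperbound) (use ev in auto)
  then show ?thesis
    by (simp add: g_def)
qed

text \<open>Since the density is even, \<open>Phi z + Phi (- z)\<close> is constant, and its limit
  at infinity is 1.\<close>

lemma Phi_0: "Phi 0 = 1 / 2"
proof -
  have even: "std_normal_density (- z) = std_normal_density z" for z :: real
    by (simp add: std_normal_density_def)
  have "((\<lambda>z. Phi z + Phi (- z)) has_real_derivative 0) (at z)" for z
    by (auto intro!: derivative_eq_intros DERIV_chain2[OF Phi_deriv] Phi_deriv simp: even)
  then have const: "Phi z + Phi (- z) = Phi 0 + Phi 0" for z
    using DERIV_isconst_all[of "\<lambda>z. Phi z + Phi (- z)" z 0] by simp
  have "((\<lambda>z. Phi z + Phi (- z)) \<longlongrightarrow> 1 + 0) at_top"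
    by (intro tendsto_add std_normal.cdf_lim_at_top_prob
        filterlim_compose[OF std_normal.cdf_lim_at_bot filterlim_uminus_at_bot_at_top])
  then show ?thesis
    unfolding const by (simp add: tendsto_const_iff)
qed

lemma std_normal_density_shift:
  "std_normal_density (x + g) = std_normal_density x * exp (- x * g - g\<^sup>2 / 2)"
  by (simp add: std_normal_density_def mult_exp_exp field_simps power2_eq_square)

text \<open>This is concavity of \<open>Phi u \<mapsto> Phi (u + s)\<close>, stated as a chord
  inequality without division. The derivative of that map is the density ratio
  \<open>exp (- u * s - s\<^sup>2 / 2)\<close>, which does not increase with
  \<open>u\<close>.\<close>

lemma Phi_shift_concave:
  assumes "x1 \<le> u" "u \<le> x2" "0 \<le> s"
  shows "(Phi u - Phi x1) * (Phi (x2 + s) - Phi (x1 + s)) \<le> (Phi (u + s) - Phi (x1 + s)) * (Phi x2 - Phi x1)"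
proof (cases "x1 = u \<or> u = x2")
  case False
  then have lt: "x1 < u" "u < x2" using assms by auto
  \<comment> \<open>\<open>S\<close> is the slope of the chord, so \<open>h\<close> agrees at
    \<open>x1\<close> and \<open>x2\<close>. A dip of \<open>h\<close> at \<open>u\<close> would
    give mean-value slopes below \<open>S\<close> left of \<open>u\<close> and above
    \<open>S\<close> right of it.\<close>
  define S where "S = (Phi (x2 + s) - Phi (x1 + s)) / (Phi x2 - Phi x1)"
  define h where "h z = Phi (z + s) - S * Phi z" for z
  have pos: "0 < Phi x2 - Phi x1" using lt by simp
  have der: "(h has_real_derivative std_normal_density z * (exp (- z * s - s\<^sup>2 / 2) - S)) (at z)" for z
  proof -
    have "(h has_real_derivative std_normal_density (z + s) * (1 + 0) - S * std_normal_density z) (at z)"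
      unfolding h_def
      by (intro DERIV_diff DERIV_cmult DERIV_chain2[OF Phi_deriv] Phi_deriv DERIV_add DERIV_ident DERIV_const)
    then show ?thesis
      unfolding std_normal_density_shift by (simp add: algebra_simps)
  qed
  have "h x1 = h x2"
    using pos by (simp add: h_def S_def field_simps)
  have "h x1 \<le> h u"
  proof (rule ccontr)
    assume neg: "\<not> h x1 \<le> h u"
    obtain z1 where z1: "x1 < z1" "z1 < u"
        "h u - h x1 = (u - x1) * (std_normal_density z1 * (exp (- z1 * s - s\<^sup>2 / 2) - S))"
      using MVT2[OF lt(1) der] by blast
    obtain z2 where z2: "u < z2" "z2 < x2"
        "h x2 - h u = (x2 - u) * (std_normal_density z2 * (exp (- z2 * s - s\<^sup>2 / 2) - S))"
      using MVT2[OF lt(2) der] by blast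
    have "(u - x1) * (std_normal_density z1 * (exp (- z1 * s - s\<^sup>2 / 2) - S)) < 0"
      using z1 neg by linarith
    then have 1: "exp (- z1 * s - s\<^sup>2 / 2) < S"
      using lt normal_density_pos[of 1 0 z1] by (simp add: mult_less_0_iff)
    have "0 < (x2 - u) * (std_normal_density z2 * (exp (- z2 * s - s\<^sup>2 / 2) - S))"
      using z2 neg \<open>h x1 = h x2\<close> by linarith
    then have 2: "S < exp (- z2 * s - s\<^sup>2 / 2)"
      using lt normal_density_pos[of 1 0 z2] by (simp add: zero_less_mult_iff)
    have "z1 * s \<le> z2 * s"
      using z1 z2 assms by (intro mult_right_mono) auto
    with 1 2 have "exp (- z1 * s - s\<^sup>2 / 2) < exp (- z1 * s - s\<^sup>2 / 2)"
      by (smt (verit) exp_le_cancel_iff mult_minus_left)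
    then show False by simp
  qed
  then have "S * (Phi u - Phi x1) \<le> Phi (u + s) - Phi (x1 + s)"
    by (simp add: h_def algebra_simps)
  then have "S * (Phi u - Phi x1) * (Phi x2 - Phi x1) \<le> (Phi (u + s) - Phi (x1 + s)) * (Phi x2 - Phi x1)"
    using pos by (intro mult_right_mono) auto
  then show ?thesis
    using pos by (simp add: S_def mult.commute)
qed (auto simp: mult.commute)

section \<open>Shifts of Gaussian mixtures\<close>

text \<open>Since the derivative of \<open>tanh\<close> is \<open>1 - tanh\<^sup>2\<close>, each
  bound integrates to the next of opposite direction: \<open>y\<close>, then
  \<open>y - y ^ 3 / 3\<close>, then \<open>y - y ^ 3 / 3 + 2 * y ^ 5 / 15\<close>. On the unit
  interval \<open>z ^ 5 \<le> z ^ 3\<close>, and -1/3 + 2/15 = -1/5.\<close>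

lemma tanh_le_cubic:
  fixes z :: real
  assumes "0 \<le> z" "z \<le> 1"
  shows "tanh z \<le> z - z ^ 3 / 5"
proof -
  have mono: "0 \<le> f y" if "f 0 = 0" "\<And>x. 0 \<le> x \<Longrightarrow> (f has_real_derivative f' x) (at x)"
      "\<And>x. 0 \<le> x \<Longrightarrow> 0 \<le> f' x" "0 \<le> y" for f f' :: "real \<Rightarrow> real" and y
    using DERIV_nonneg_imp_nondecreasing[of 0 y f] that by fastforce
  have t1: "tanh y \<le> y" if "0 \<le> y" for y :: real
  proof -
    have "0 \<le> y - tanh y"
      by (rule mono[of "\<lambda>y. y - tanh y" "\<lambda>y. tanh y ^ 2" y])
         (use that in \<open>auto intro!: derivative_eq_intros\<close>)
    then show ?thesis by simp
  qed
  have t2: "y - y ^ 3 / 3 \<le> tanh y" if "0 \<le> y" for y :: real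
  proof -
    have "0 \<le> tanh y - (y - y ^ 3 / 3)"
      by (rule mono[of "\<lambda>y. tanh y - (y - y ^ 3 / 3)" "\<lambda>y. y ^ 2 - tanh y ^ 2" y])
         (use that t1 in \<open>auto intro!: derivative_eq_intros power_mono\<close>)
    then show ?thesis by simp
  qed
  have t3: "tanh y \<le> y - y ^ 3 / 3 + 2 * y ^ 5 / 15" if "0 \<le> y" "y \<le> 1" for y :: real
  proof -
    have sq: "x ^ 2 \<le> 2 * x ^ 4 / 3 + tanh x ^ 2" if "0 \<le> x" "x \<le> 1" for x :: real
    proof -
      have "0 \<le> x - x ^ 3 / 3"
        using that mult_left_le[of "x\<^sup>2 / 3" x] power_le_one[of x 2]
        by (simp add: power3_eq_cube power2_eq_square)
      then have "(x - x ^ 3 / 3) ^ 2 \<le> tanh x ^ 2"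
        using t2[OF that(1)] by (intro power_mono)
      moreover have "(x - x ^ 3 / 3) ^ 2 = x ^ 2 - 2 * x ^ 4 / 3 + (x ^ 3) ^ 2 / 9"
        by (simp add: power2_eq_square algebra_simps power_numeral_reduce)
      ultimately show ?thesis
        using zero_le_power2[of "x ^ 3"] by linarith
    qed
    then have "(\<lambda>y. y - y ^ 3 / 3 + 2 * y ^ 5 / 15 - tanh y) 0 \<le> 
        (\<lambda>y. y - y ^ 3 / 3 + 2 * y ^ 5 / 15 - tanh y) y"
      using that
      by (intro DERIV_nonneg_imp_nondecreasing[where f = "\<lambda>y. y - y ^ 3 / 3 + 2 * y ^ 5 / 15 - tanh y"])
         (auto intro!: derivative_eq_intros exI simp: sq)
    then show ?thesis by simp
  qed
  have "z ^ 5 \<le> z ^ 3"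
    using assms by (intro power_decreasing) auto
  then show ?thesis
    using t3[OF assms] by simp
qed

text \<open>Dividing by the product on the right, the left side is the change of the weight
  \<open>B / (A + B)\<close> when \<open>B\<close> is tilted by \<open>exp h\<close>. With
  \<open>e = exp (h / 2)\<close> the bound reduces to \<open>0 \<le> (A - B * e)\<^sup>2\<close>,
  because \<open>tanh (h / 4) = (e - 1) / (e + 1)\<close>.\<close>

lemma two_point_tilt_le:
  fixes A B h H :: real
  assumes "0 < A" "0 < B" "h \<le> H" "0 \<le> H"
  shows "A * B * (exp h - 1) \<le> tanh (H / 4) * ((A + B * exp h) * (A + B))"
proof (cases "h \<le> 0")
  case True
  have "A * B * (exp h - 1) \<le> 0"
    using True assms by (intro mult_nonneg_nonpos) auto
  also have "0 \<le> tanh (H / 4) * ((A + B * exp h) * (A + B))"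
    using assms by (intro mult_nonneg_nonneg add_nonneg_nonneg) auto
  finally show ?thesis .
next
  case False
  define e where "e = exp (h / 2)"
  have e: "1 < e" "exp h = e ^ 2"
    using False by (simp_all add: e_def power2_eq_square mult_exp_exp)
  have t: "tanh (h / 4) = (e - 1) / (e + 1)"
  proof -
    have "exp (h / 2) * exp (- h / 2) = 1"
      by (simp add: mult_exp_exp)
    then show ?thesis
      unfolding tanh_real_altdef e_def
      by (simp add: divide_simps exp_minus add_pos_pos)
  qed
  have "A * B * (e + 1) ^ 2 \<le> (A + B * e ^ 2) * (A + B)"
    using zero_le_power2[of "A - B * e"] by (simp add: algebra_simps power2_eq_square)
  then have "(e - 1) / (e + 1) * (A * B * (e + 1) ^ 2) \<le> (e - 1) / (e + 1) * ((A + B * e ^ 2) * (A + B))"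
    using e by (intro mult_left_mono) auto
  moreover have "(e - 1) / (e + 1) * (A * B * (e + 1) ^ 2) = A * B * (e ^ 2 - 1)"
    using e(1) by (simp add: power2_eq_square) (simp add: algebra_simps)
  ultimately have "A * B * (exp h - 1) \<le> tanh (h / 4) * ((A + B * exp h) * (A + B))"
    by (simp add: t e)
  also have "\<dots> \<le> tanh (H / 4) * ((A + B * exp h) * (A + B))"
    using assms by (intro mult_right_mono) auto
  finally show ?thesis .
qed

section \<open>The inverse of \<open>Phi\<close> and the comparison of mixtures\<close>

lemma inv_Phi [simp]: "inv Phi (Phi x) = x"
  by (simp add: inv_f_f strict_mono_imp_inj_on[OF Phi_strict_mono])

lemma Phi_inv:
  assumes "0 < a" "a < 1"
  shows "Phi (inv Phi a) = a"
  using Phi_surj[OF assms] by (metis inv_Phi)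

lemma inv_Phi_deriv:
  assumes "0 < a" "a < 1"
  shows "(inv Phi has_real_derivative inverse (std_normal_density (inv Phi a))) (at a)"
proof (rule DERIV_inverse_function)
  show "isCont (inv Phi) a"
    using isCont_inverse_function[of 1 "inv Phi a" "inv Phi" Phi] isCont_Phi Phi_inv[OF assms] by simp
  show "std_normal_density (inv Phi a) \<noteq> 0"
    using normal_density_pos[of 1 0 "inv Phi a"] by simp
qed (use assms Phi_deriv Phi_inv in auto)

text \<open>
  As the distance \<open>d\<close> of the two components grows from \<open>0\<close> to \<open>D\<close> at constant value of
  the mixture, the first component sits at \<open>r\<close> and the second at \<open>Y r = r - d\<close>.  A second
  such pair is kept at distance \<open>gam d\<close> from the first one, and \<open>gam\<close> is chosen
  so that the value of its mixture cannot decrease.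
\<close>

lemma Phi_mixture_shift:
  fixes p x u D s :: real
  assumes p: "0 < p" "p < 1" and D: "0 < D" and s: "0 < s" and Ds: "D * s \<le> 4"
    and u: "Phi u = p * Phi x + (1 - p) * Phi (x - D)"
  shows "Phi (u + (s - D\<^sup>2 * s / 8 + D ^ 4 * s ^ 3 / 1280))
           \<le> p * Phi (x + s) + (1 - p) * Phi (x - D + s)"
proof -
  define w where "w r = (Phi u - p * Phi r) / (1 - p)" for r
  define Y where "Y r = inv Phi (w r)" for r
  \<comment> \<open>The derivative of \<open>gam\<close> at \<open>d\<close> is
    \<open>z - z ^ 3 / 5\<close> with \<open>z = d * s / 4\<close>, the cubic bound for
    \<open>tanh z\<close>. The constant is fixed by \<open>gam D = s\<close>, and
    \<open>gam 0\<close> is the shift claimed.\<close>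
  define gam where "gam d = s - s * (D\<^sup>2 - d\<^sup>2) / 8 + (s / 4) ^ 3 * (D ^ 4 - d ^ 4) / 20" for d
  \<comment> \<open>At \<open>r = u\<close> both components coincide and \<open>L\<close> is the
    left side of the claim; at \<open>r = x\<close> it is the right side. It remains to see that
    \<open>L\<close> does not decrease.\<close>
  define L where "L r = p * Phi (r + gam (r - Y r)) + (1 - p) * Phi (Y r + gam (r - Y r))" for r
  have wx: "w x = Phi (x - D)" and wu: "w u = Phi u"
    using p u by (simp_all add: w_def field_simps)
  have Yx: "Y x = x - D" and Yu: "Y u = u"
    by (simp_all add: Y_def wx wu)
  have ux: "u < x"
  proof -
    have "(1 - p) * Phi (x - D) < (1 - p) * Phi x"
      using p D by simp
    then have "Phi u < Phi x"
      unfolding u by (simp add: algebra_simps)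
    then show ?thesis by simp
  qed
  have step: "\<exists>L'. (L has_real_derivative L') (at r) \<and> 0 \<le> L'" if r: "u \<le> r" "r \<le> x" for r
  proof -
    have "w x \<le> w r" "w r \<le> w u"
      using r p by (auto simp: w_def intro!: divide_right_mono)
    then have w01: "0 < w r" "w r < 1" and wr: "Phi (x - D) \<le> w r" "w r \<le> Phi u"
      using Phi_pos[of "x - D"] Phi_less_1[of u] by (simp_all add: wx wu)
    have PY: "Phi (Y r) = w r"
      unfolding Y_def using w01 by (rule Phi_inv)
    define d where "d = r - Y r"
    have "x - D \<le> Y r" "Y r \<le> u"
      using wr unfolding PY[symmetric] by simp_all
    then have d: "0 \<le> d" "d \<le> D"
      using r by (simp_all add: d_def)
    define g where "g = gam d"
    define k where "k = d * s / 4 - (d * s / 4) ^ 3 / 5"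
    define A where "A = p * std_normal_density r"
    define B where "B = (1 - p) * std_normal_density (Y r)"
    have AB: "0 < A" "0 < B"
      using p by (simp_all add: A_def B_def normal_density_pos)
    \<comment> \<open>With \<open>s * (D\<^sup>2 - d\<^sup>2)\<close> factored out, the quartic
      correction has coefficient at most 32/1280, below the 1/8 of the quadratic loss.\<close>
    have gs: "g \<le> s"
    proof -
      have "(D * s) ^ 2 \<le> 4 ^ 2"
        using D s Ds by (intro power_mono) auto
      then have ds: "s\<^sup>2 * D\<^sup>2 \<le> 16"
        by (simp add: power_mult_distrib mult.commute)
      have "d\<^sup>2 \<le> D\<^sup>2"
        using d by (intro power_mono) auto
      then have "s\<^sup>2 * (D\<^sup>2 + d\<^sup>2) \<le> 32"
        using ds mult_left_mono[of "d\<^sup>2" "D\<^sup>2" "s\<^sup>2"] by (simp add: algebra_simps)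
      then have "s * (D\<^sup>2 - d\<^sup>2) * (s\<^sup>2 * (D\<^sup>2 + d\<^sup>2)) \<le> s * (D\<^sup>2 - d\<^sup>2) * 32"
        using s \<open>d\<^sup>2 \<le> D\<^sup>2\<close> by (intro mult_left_mono) auto
      moreover have "g = s - s * (D\<^sup>2 - d\<^sup>2) / 8 + s * (D\<^sup>2 - d\<^sup>2) * (s\<^sup>2 * (D\<^sup>2 + d\<^sup>2)) / 1280"
        by (simp add: g_def gam_def field_simps power_numeral_reduce)
      moreover have "0 \<le> s * (D\<^sup>2 - d\<^sup>2)"
        using s \<open>d\<^sup>2 \<le> D\<^sup>2\<close> by simp
      ultimately show ?thesis by linarith
    qed
    \<comment> \<open>Implicit differentiation of
      \<open>p * Phi r + (1 - p) * Phi (Y r) = Phi u\<close>.\<close>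
    have Yder: "(Y has_real_derivative - (A / B)) (at r)"
    proof -
      have "(w has_real_derivative (- (p * std_normal_density r) / (1 - p))) (at r)"
        unfolding w_def using p by (auto intro!: derivative_eq_intros Phi_deriv)
      then have "(Y has_real_derivative inverse (std_normal_density (inv Phi (w r))) *
          (- (p * std_normal_density r) / (1 - p))) (at r)"
        unfolding Y_def using inv_Phi_deriv[OF w01] by (rule DERIV_chain2[rotated])
      then show ?thesis
        by (simp add: A_def B_def Y_def field_simps)
    qed
    have gder: "(gam has_real_derivative k) (at d)"
      unfolding gam_def k_def
      by (auto intro!: derivative_eq_intros simp: field_simps power_numeral_reduce)
    have gYder: "((\<lambda>r. gam (r - Y r)) has_real_derivative k * (1 + A / B)) (at r)"
      by (rule DERIV_chain2[of gam k "\<lambda>r. r - Y r"])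
         (use gder Yder in \<open>auto intro!: derivative_eq_intros simp: d_def\<close>)
    define A2 where "A2 = p * std_normal_density (r + g)"
    define B2 where "B2 = (1 - p) * std_normal_density (Y r + g)"
    have "(L has_real_derivative
        p * (std_normal_density (r + g) * (1 + k * (1 + A / B))) +
        (1 - p) * (std_normal_density (Y r + g) * (- (A / B) + k * (1 + A / B)))) (at r)"
      unfolding L_def g_def d_def
      by (intro DERIV_add DERIV_cmult DERIV_chain2[OF Phi_deriv] gYder Yder DERIV_ident)
    then have Lder: "(L has_real_derivative
        A2 * (1 + k * (1 + A / B)) + B2 * (- (A / B) + k * (1 + A / B))) (at r)"
      by (simp add: A2_def B2_def mult.assoc)
    have A2: "A2 = A * exp (- r * g - g\<^sup>2 / 2)"
      by (simp add: A2_def A_def std_normal_density_shift)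
    have B2: "B2 = B * exp (- r * g - g\<^sup>2 / 2) * exp (d * g)"
    proof -
      have "- r * g - g\<^sup>2 / 2 + d * g = - Y r * g - g\<^sup>2 / 2"
        by (simp add: d_def algebra_simps)
      then show ?thesis
        by (simp only: B2_def B_def std_normal_density_shift mult.assoc mult_exp_exp)
    qed
    define e where "e = exp (- r * g - g\<^sup>2 / 2)"
    have "e > 0" by (simp add: e_def)
    have kt: "tanh (d * s / 4) \<le> k"
      unfolding k_def
    proof (rule tanh_le_cubic)
      have "d * s \<le> D * s"
        using d s by simp
      then show "d * s / 4 \<le> 1"
        using Ds by linarith
    qed (use d s in simp)
    have "A * B * (exp (d * g) - 1) \<le> tanh (d * s / 4) * ((A + B * exp (d * g)) * (A + B))"
      using AB d s gs by (intro two_point_tilt_le mult_left_mono mult_nonneg_nonneg) auto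
    also have "\<dots> \<le> k * ((A + B * exp (d * g)) * (A + B))"
      using AB kt by (intro mult_right_mono mult_nonneg_nonneg add_nonneg_nonneg) auto
    \<comment> \<open>Shifting both components by \<open>g\<close> multiplies their densities by
      \<open>e\<close> and \<open>e * exp (d * g)\<close>. The derivative of \<open>L\<close> then
      factors into this positive multiple of the bracket just shown to be nonnegative.\<close>
    finally have "0 \<le> e / B * (k * ((A + B * exp (d * g)) * (A + B)) - A * B * (exp (d * g) - 1))"
      using AB \<open>e > 0\<close> by simp
    also have "\<dots> = A2 * (1 + k * (1 + A / B)) + B2 * (- (A / B) + k * (1 + A / B))"
      using AB unfolding A2 B2 e_def[symmetric] by (simp add: field_simps)
    finally show ?thesis
      using Lder by blast
  qed
  have "L u \<le> L x"
    using DERIV_nonneg_imp_nondecreasing[of u x L] ux step by simp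
  moreover have "gam D = s" "gam 0 = s - D\<^sup>2 * s / 8 + D ^ 4 * s ^ 3 / 1280"
    by (simp_all add: gam_def field_simps power_numeral_reduce)
  ultimately show ?thesis
    using p by (simp add: L_def Yx Yu algebra_simps)
qed

text \<open>The analytic form of the induction step: \<open>a v\<close> are the densities of the
  slices, \<open>b v\<close> those of the slices of the neighbourhood, \<open>Phi x\<close> is the
  largest slice density, and \<open>D\<close> is the shift lost by spending one change on moving to
  another slice.\<close>

lemma Phi_average_shift:
  fixes a b :: "'v \<Rightarrow> real"
  assumes V: "finite V" "V \<noteq> {}"
    and D: "0 < D" and s: "0 < s" and Ds: "D * s \<le> 4"
    and s': "s' \<le> s - D\<^sup>2 * s / 8 + D ^ 4 * s ^ 3 / 1280"
    and a_le: "\<And>v. v \<in> V \<Longrightarrow> a v \<le> Phi x"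
    and b_ge: "\<And>v. v \<in> V \<Longrightarrow> Phi (x - D + s) \<le> b v"
    and shift: "\<And>v u. v \<in> V \<Longrightarrow> Phi u \<le> a v \<Longrightarrow> Phi (u + s) \<le> b v"
    and x0: "Phi x0 \<le> sum a V / card V"
  shows "Phi (x0 + s') \<le> sum b V / card V"
proof -
  define S where "S = (Phi (x + s) - Phi (x - D + s)) / (Phi x - Phi (x - D))"
  \<comment> \<open>The line through the points of the graph of
    \<open>Phi u \<mapsto> Phi (u + s)\<close> over \<open>u = x - D\<close> and
    \<open>u = x\<close>. Being affine, it commutes with averaging over \<open>V\<close>.\<close>
  define chord where "chord z = Phi (x - D + s) + S * (z - Phi (x - D))" for z
  define alpha where "alpha = sum a V / card V"
  have pos: "0 < Phi x - Phi (x - D)" using D by simp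
  have S: "0 < S" using D by (simp add: S_def)
  have cV: "0 < real (card V)" using V by (simp add: card_gt_0_iff)
  have "(D * s)\<^sup>2 \<le> 4\<^sup>2"
    using Ds D s by (intro power_mono) auto
  then have "D\<^sup>2 * s * (D * s)\<^sup>2 \<le> D\<^sup>2 * s * 16"
    using s by (intro mult_left_mono) auto
  then have "D ^ 4 * s ^ 3 \<le> 16 * (D\<^sup>2 * s)"
    by (simp add: power_mult_distrib power_numeral_reduce mult_ac)
  moreover have "0 \<le> D\<^sup>2 * s" using s by simp
  ultimately have s's: "s' \<le> s" using s' by linarith
  \<comment> \<open>Between the two nodes this is concavity; to the left of both, the chord lies
    below its value at the left node, which \<open>b_ge\<close> bounds.\<close>
  have chord_le: "chord (a v) \<le> b v" if v: "v \<in> V" for v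
  proof (cases "a v \<le> Phi (x - D)")
    case True
    then have "S * (a v - Phi (x - D)) \<le> 0"
      using S by (intro mult_nonneg_nonpos) auto
    then show ?thesis
      using b_ge[OF v] by (simp add: chord_def)
  next
    case False
    then have "0 < a v" "a v < 1"
      using Phi_pos[of "x - D"] a_le[OF v] Phi_less_1[of x] by linarith+
    then obtain u where u: "Phi u = a v" by (rule Phi_surj)
    have "x - D \<le> u" "u \<le> x"
      using False a_le[OF v] unfolding u[symmetric] by simp_all
    then have "(Phi u - Phi (x - D)) * (Phi (x + s) - Phi (x - D + s))
        \<le> (Phi (u + s) - Phi (x - D + s)) * (Phi x - Phi (x - D))"
      using s by (intro Phi_shift_concave) auto
    then have "chord (a v) \<le> Phi (u + s)"
      using pos by (simp add: chord_def S_def u field_simps)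
    then show ?thesis
      using shift[OF v, of u] u by simp
  qed
  have "chord alpha = (\<Sum>v\<in>V. chord (a v)) / card V"
    using cV by (simp add: chord_def alpha_def sum.distrib sum_distrib_left[symmetric] sum_subtractf field_simps)
  also have "\<dots> \<le> sum b V / card V"
    using chord_le by (intro divide_right_mono sum_mono) auto
  finally have chord_alpha: "chord alpha \<le> sum b V / card V" .
  show ?thesis
  proof (cases "alpha \<le> Phi (x - D)")
    case True
    with x0 have "Phi x0 \<le> Phi (x - D)"
      unfolding alpha_def by (rule order_trans)
    then have "Phi (x0 + s') \<le> Phi (x - D + s)" using s's by simp
    also have "\<dots> \<le> sum b V / card V"
      using sum_mono[of V "\<lambda>_. Phi (x - D + s)" b] b_ge cV by (simp add: field_simps)
    finally show ?thesis .
  next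
    case False
    have "alpha \<le> Phi x"
      using sum_mono[of V a "\<lambda>_. Phi x"] a_le cV by (simp add: alpha_def field_simps)
    with False have "0 < alpha" "alpha < 1"
      using Phi_pos[of "x - D"] Phi_less_1[of x] by linarith+
    then obtain u where u: "Phi u = alpha" by (rule Phi_surj)
    have ux: "x - D < u" "u \<le> x" "x0 \<le> u"
      using False \<open>alpha \<le> Phi x\<close> x0 unfolding alpha_def[symmetric] u[symmetric] by simp_all
    have "Phi (u + s') \<le> chord (Phi u)"
    proof (cases "u = x")
      case True
      have "chord (Phi x) = Phi (x + s)"
        using pos by (simp add: chord_def S_def)
      then show ?thesis using True s's by simp
    next
      case False
      \<comment> \<open>The weight that makes the average \<open>Phi u\<close> a mixture of the two
        nodes; the value of the chord there is the same mixture of the shifted nodes.\<close>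
      define p where "p = (Phi u - Phi (x - D)) / (Phi x - Phi (x - D))"
      have p: "0 < p" "p < 1"
        using pos ux False by (simp_all add: p_def)
      have pp: "p * (Phi x - Phi (x - D)) = Phi u - Phi (x - D)"
        using pos by (simp add: p_def)
      have "Phi (u + s') \<le> Phi (u + (s - D\<^sup>2 * s / 8 + D ^ 4 * s ^ 3 / 1280))"
        using s' by simp
      also have "\<dots> \<le> p * Phi (x + s) + (1 - p) * Phi (x - D + s)"
        using p D s Ds pp by (intro Phi_mixture_shift) (auto simp: algebra_simps)
      also have "\<dots> = chord (Phi u)"
        unfolding chord_def S_def pp[symmetric] using pos by (simp add: field_simps)
      finally show ?thesis .
    qed
    moreover have "Phi (x0 + s') \<le> Phi (u + s')"
      using ux by simp
    ultimately show ?thesis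
      using chord_alpha unfolding u by linarith
  qed
qed

section \<open>Isoperimetry in Hamming spaces\<close>

text \<open>
  The simpler shift \<open>2 t / sqrt N\<close> does not satisfy the recursion below: passing from \<open>N\<close> to
  \<open>N + 1\<close> costs slightly too much when \<open>t\<close> is of order \<open>sqrt N\<close>.  The total of these
  losses is bounded, and is absorbed by lowering \<open>t\<close> by \<open>1 - 1 / sqrt N\<close>.
\<close>

definition gain :: "nat \<Rightarrow> nat \<Rightarrow> real" where
  "gain N t = (if t = 0 then 0 else 2 * (real t - 1) / sqrt (real N) + 2 / real N)"

text \<open>A rational bound for \<open>1 / sqrt (1 + 1 / N)\<close>, slightly sharper than its
  second-order Taylor polynomial in \<open>1 / N\<close>; proved by squaring.\<close>

lemma inverse_sqrt_Suc_le:
  assumes "N \<ge> 1"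
  shows "1 / sqrt (real (Suc N)) \<le> 1 / sqrt (real N) * (1 - 1 / (2 * real N) + 3 / (8 * real N ^ 2 + 4 * real N))"
proof -
  define a where "a = real N"
  have a: "a \<ge> 1" using assms by (simp add: a_def)
  define m where "m = 1 - 1 / (2 * a) + 3 / (8 * a ^ 2 + 4 * a)"
  have "8 * a\<^sup>2 + 4 * a \<noteq> 0"
    using a by (intro less_imp_neq[symmetric] add_pos_pos) auto
  then have m: "m = (8 * a\<^sup>2 + 1) / (8 * a\<^sup>2 + 4 * a)"
    using a by (simp add: m_def divide_simps) (simp add: algebra_simps power2_eq_square)
  have "0 < m" unfolding m using a by (intro divide_pos_pos add_pos_pos) auto
  have "m\<^sup>2 * (a + 1) \<ge> a"
  proof -
    \<comment> \<open>The right side exceeds the left by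
      \<open>16 * a\<^sup>2 + a + 1\<close>.\<close>
    have "a * (8 * a\<^sup>2 + 4 * a)\<^sup>2 \<le> (8 * a\<^sup>2 + 1)\<^sup>2 * (a + 1)"
      using a by (simp add: algebra_simps power2_eq_square)
    moreover have "0 < (8 * a\<^sup>2 + 4 * a)\<^sup>2"
      using a by (intro zero_less_power add_pos_pos) auto
    ultimately show ?thesis
      unfolding m power_divide by (simp add: field_simps)
  qed
  then have "sqrt a \<le> sqrt (m\<^sup>2 * (a + 1))"
    by simp
  then have "sqrt a \<le> m * sqrt (a + 1)"
    using \<open>0 < m\<close> by (simp add: real_sqrt_mult)
  then show ?thesis
    using a unfolding m_def[symmetric] a_def[symmetric] of_nat_Suc
    by (simp add: a_def[symmetric] field_simps)
qed

lemma gain_pos: "N \<ge> 1 \<Longrightarrow> t \<ge> 1 \<Longrightarrow> 0 < gain N t"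
  by (simp add: gain_def add_nonneg_pos)

text \<open>These are the conditions of \<open>Phi_average_shift\<close> for
  \<open>s = gain N t\<close> and \<open>s' = gain (Suc N) t\<close>. The case \<open>t = 1\<close>
  is separate because \<open>gain N 0\<close> is 0 by convention: there \<open>D\<close> is
  \<open>2 / N\<close>, otherwise \<open>2 / sqrt N\<close>.\<close>

lemma gain_recursion:
  assumes "1 \<le> t" "t \<le> N" and D: "D = gain N t - gain N (t - 1)"
  shows "0 < D" "D * gain N t \<le> 4"
    "gain (Suc N) t \<le> gain N t - D\<^sup>2 * gain N t / 8 + D ^ 4 * gain N t ^ 3 / 1280"
proof -
  define a where "a = real N"
  have a: "a \<ge> 1" using assms by (simp add: a_def)
  consider "t = 1" | "t \<ge> 2" using assms by linarith
  then have "0 < D \<and> D * gain N t \<le> 4 \<and>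
      gain (Suc N) t \<le> gain N t - D\<^sup>2 * gain N t / 8 + D ^ 4 * gain N t ^ 3 / 1280"
  proof cases
    case 1
    have g: "gain N t = 2 / a" "D = 2 / a" "gain (Suc N) t = 2 / (a + 1)"
      using 1 D by (simp_all add: gain_def a_def)
    have "a\<^sup>2 \<ge> a" using a by (simp add: power2_eq_square)
    have "2 / (a + 1) \<le> 2 / a - 1 / a ^ 3"
    proof -
      have "2 / a - 1 / a ^ 3 - 2 / (a + 1) = (2 * a\<^sup>2 - a - 1) / (a ^ 3 * (a + 1))"
        using a by (simp add: field_simps power_numeral_reduce)
      moreover have "0 \<le> (2 * a\<^sup>2 - a - 1) / (a ^ 3 * (a + 1))"
        using a \<open>a\<^sup>2 \<ge> a\<close> by (intro divide_nonneg_nonneg) auto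
      ultimately show ?thesis by linarith
    qed
    also have "\<dots> = gain N t - D\<^sup>2 * gain N t / 8"
      using a by (simp add: g field_simps power_numeral_reduce)
    also have "\<dots> \<le> \<dots> + D ^ 4 * gain N t ^ 3 / 1280"
      using a by (simp add: g)
    finally have "gain (Suc N) t \<le> gain N t - D\<^sup>2 * gain N t / 8 + D ^ 4 * gain N t ^ 3 / 1280"
      by (simp add: g)
    moreover have "D * gain N t \<le> 4"
      using a \<open>a\<^sup>2 \<ge> a\<close> by (simp add: g power2_eq_square[symmetric] divide_simps)
    ultimately show ?thesis
      using a by (simp add: g)
  next
    case 2
    define q where "q = sqrt a"
    have q: "q \<ge> 1" "q\<^sup>2 = a" using a by (simp_all add: q_def)
    have a2: "a \<ge> 2" using 2 assms by (simp add: a_def)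
    define j where "j = real t - 1"
    have j: "1 \<le> j" "j \<le> a - 1" using 2 assms by (simp_all add: a_def j_def)
    define r where "r = j / q + 1 / a"
    have r: "gain N t = 2 * r" "gain (Suc N) t = 2 * (j / sqrt (a + 1) + 1 / (a + 1))"
      using 2 by (simp_all add: gain_def r_def j_def q_def a_def add.commute)
    have Dq: "D = 2 / q"
      using 2 D by (simp add: gain_def q_def a_def of_nat_diff flip: diff_divide_distrib)
    have "j / a + 1 / (a * q) \<le> (a - 1) / a + 1 / a"
      using j a q by (intro add_mono divide_right_mono divide_left_mono) auto
    also have "\<dots> = 1" using a by (simp add: field_simps)
    finally have "r / q \<le> 1"
      using q a by (simp add: r_def add_divide_distrib power2_eq_square[symmetric])
    then have Dg: "D * gain N t \<le> 4"
      by (simp add: Dq r)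
    define k where "k = 3 * a / (8 * a + 4)"
    have k: "0 \<le> k" "k \<le> 3 / 8" using a by (simp_all add: k_def field_simps)
    have "1 / sqrt (a + 1) \<le> 1 / q * (1 - 1 / (2 * a) + 3 / (8 * a\<^sup>2 + 4 * a))"
      using inverse_sqrt_Suc_le[of N] assms by (simp add: a_def q_def add.commute)
    then have "j * (1 / sqrt (a + 1)) \<le> j * (1 / q * (1 - 1 / (2 * a) + 3 / (8 * a\<^sup>2 + 4 * a)))"
      using j by (intro mult_left_mono) auto
    also have "3 / (8 * a\<^sup>2 + 4 * a) = k / a\<^sup>2"
    proof -
      have "8 * a\<^sup>2 + 4 * a = a * (8 * a + 4)"
        by (simp add: power2_eq_square algebra_simps)
      then show ?thesis
        using a by (simp add: k_def power2_eq_square)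
    qed
    finally have js: "j / sqrt (a + 1) \<le> (r - 1 / a) * (1 - 1 / (2 * a) + k / a\<^sup>2)"
      by (simp add: r_def)
    have "1 / q \<le> j / q"
      using j q by (intro divide_right_mono) auto
    then have rq: "1 / q + 1 / a \<le> r" and r0: "0 \<le> r"
      using q a j by (simp_all add: r_def)
    \<comment> \<open>This is \<open>a\<^sup>2\<close> times the slack in the halved recursion,
      after bounding \<open>1 / sqrt (a + 1)\<close> and writing \<open>r\<close> for half of
      \<open>gain N t\<close>.\<close>
    have main: "0 \<le> 1 / 2 - 1 / (a + 1) + k / a - k * r + r ^ 3 / 20"
    proof -
      \<comment> \<open>The cubic \<open>r ^ 3 / 20\<close> lies above its tangent at 8/5, whose
        slope 0.384 is just above the bound 3/8 for \<open>k\<close>, so the coefficient of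
        \<open>r\<close> becomes nonnegative.\<close>
      have "0 \<le> (r - 8 / 5)\<^sup>2 * (r + 16 / 5)"
        using r0 by simp
      moreover have "(r - 8 / 5)\<^sup>2 * (r + 16 / 5) = r ^ 3 - 192 / 25 * r + 1024 / 125"
        by (simp add: power_numeral_reduce field_simps)
      ultimately have tangent: "384 / 1000 * r - 4096 / 10000 \<le> r ^ 3 / 20"
        by linarith
      have qle: "1 / y \<le> 1 / q" if "a \<le> y\<^sup>2" "0 < y" for y
        using that q real_le_lsqrt[of y a] by (intro divide_left_mono) (auto simp: q_def)
      \<comment> \<open>For \<open>N \<ge> 6\<close> the constant part alone is nonnegative. For
        \<open>N\<close> from 2 to 5 the bound \<open>1 / q + 1 / a \<le> r\<close> is used, with a
        rational upper bound for \<open>sqrt N\<close>.\<close>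
      have "0 \<le> 904 / 10000 - 1 / (a + 1) + k / a + (384 / 1000 - k) * r"
      proof -
        consider "N = 2" | "N = 3" | "N = 4" | "N = 5" | "N \<ge> 6"
          using a2 by (fastforce simp: a_def)
        then show ?thesis
        proof cases
          case 1
          with rq qle[of "10 / 7"] show ?thesis by (simp add: a_def k_def power2_eq_square)
        next
          case 2
          with rq qle[of "7 / 4"] show ?thesis by (simp add: a_def k_def power2_eq_square)
        next
          case 3
          with rq qle[of "2"] show ?thesis by (simp add: a_def k_def power2_eq_square)
        next
          case 4
          with rq qle[of "9 / 4"] show ?thesis by (simp add: a_def k_def power2_eq_square)
        next
          case 5
          then have a6: "6 \<le> a" by (simp add: a_def)
          have "6 * a \<le> a * a" using a6 by (intro mult_right_mono) auto
          moreover have "904 / 10000 * (a + 1) * (8 * a + 4) - (8 * a + 4) + 3 * (a + 1) =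
              7232 / 10000 * (a * a) - 39152 / 10000 * a - 6384 / 10000"
            by (simp add: field_simps)
          ultimately have "0 \<le> 904 / 10000 * (a + 1) * (8 * a + 4) - (8 * a + 4) + 3 * (a + 1)"
            using a6 by linarith
          then have "0 \<le> (904 / 10000 * (a + 1) * (8 * a + 4) - (8 * a + 4) + 3 * (a + 1)) / ((a + 1) * (8 * a + 4))"
            using a6 by (intro divide_nonneg_nonneg) auto
          also have "\<dots> = 904 / 10000 - 1 / (a + 1) + 3 / (8 * a + 4)"
          proof -
            have eq: "(p * x * y - y + 3 * x) / (x * y) = p - 1 / x + 3 / y"
              if "x \<noteq> 0" "y \<noteq> 0" for p x y :: real
              using that by (simp add: field_simps)
            show ?thesis by (rule eq) (use a6 in auto)
          qed
          also have "3 / (8 * a + 4) = k / a"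
            using a6 by (simp add: k_def)
          also have "0 \<le> (384 / 1000 - k) * r"
            using k r0 by (intro mult_nonneg_nonneg) auto
          ultimately show ?thesis by linarith
        qed
      qed
      with tangent show ?thesis by (simp add: algebra_simps)
    qed
    have "(r - r / (2 * a) + r ^ 3 / (20 * a\<^sup>2)) -
        ((r - 1 / a) * (1 - 1 / (2 * a) + k / a\<^sup>2) + 1 / (a + 1))
        = (1 / 2 - 1 / (a + 1) + k / a - k * r + r ^ 3 / 20) / a\<^sup>2"
      using a by (simp add: divide_simps) (simp add: algebra_simps power2_eq_square)
    also have "\<dots> \<ge> 0"
      using main by simp
    finally have "j / sqrt (a + 1) + 1 / (a + 1) \<le> r - r / (2 * a) + r ^ 3 / (20 * a\<^sup>2)"
      using js by linarith
    moreover have "D\<^sup>2 = 4 / a" "D ^ 4 = 16 / a\<^sup>2"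
    proof -
      show D2: "D\<^sup>2 = 4 / a"
        by (simp add: Dq power_divide q)
      have "D ^ 4 = (D\<^sup>2)\<^sup>2" by (simp flip: power_mult)
      then show "D ^ 4 = 16 / a\<^sup>2" by (simp add: D2 power_divide)
    qed
    ultimately show ?thesis
      using Dg q unfolding r by (simp add: Dq field_simps power_mult_distrib)
  qed
  then show "0 < D" "D * gain N t \<le> 4"
    "gain (Suc N) t \<le> gain N t - D\<^sup>2 * gain N t / 8 + D ^ 4 * gain N t ^ 3 / 1280"
    by auto
qed

section \<open>Neighbourhoods, densities and slices in finite powers\<close>

definition nbhd :: "'i set \<Rightarrow> 'v set \<Rightarrow> nat \<Rightarrow> ('i \<Rightarrow> 'v) set \<Rightarrow> ('i \<Rightarrow> 'v) set" where
  "nbhd I V t A = {g \<in> I \<rightarrow>\<^sub>E V. \<exists>f\<in>A. card {i \<in> I. f i \<noteq> g i} \<le> t}"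

definition dens :: "'i set \<Rightarrow> 'v set \<Rightarrow> ('i \<Rightarrow> 'v) set \<Rightarrow> real" where
  "dens I V A = real (card A) / real (card V) ^ card I"

text \<open>The fixed coordinate is removed, so that a slice is a subset of the smaller power and
  the induction hypothesis applies to it.\<close>

definition slice :: "'i set \<Rightarrow> 'v set \<Rightarrow> 'i \<Rightarrow> ('i \<Rightarrow> 'v) set \<Rightarrow> 'v \<Rightarrow> ('i \<Rightarrow> 'v) set" where
  "slice I V i A v = {f \<in> I \<rightarrow>\<^sub>E V. f(i := v) \<in> A}"

lemma nbhdI: "f \<in> A \<Longrightarrow> g \<in> I \<rightarrow>\<^sub>E V \<Longrightarrow> card {i \<in> I. f i \<noteq> g i} \<le> t \<Longrightarrow> g \<in> nbhd I V t A"
  by (auto simp: nbhd_def)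

lemma nbhd_subset: "nbhd I V t A \<subseteq> I \<rightarrow>\<^sub>E V"
  by (auto simp: nbhd_def)

lemma subset_nbhd: "A \<subseteq> I \<rightarrow>\<^sub>E V \<Longrightarrow> A \<subseteq> nbhd I V t A"
  by (auto simp: nbhd_def intro!: bexI)

lemma nbhd_eq_all:
  assumes "finite I" "card I \<le> t" "A \<noteq> {}"
  shows "nbhd I V t A = I \<rightarrow>\<^sub>E V"
proof -
  have "card {i \<in> I. f i \<noteq> g i} \<le> t" for f g :: "'a \<Rightarrow> 'b"
    using card_mono[of I "{i \<in> I. f i \<noteq> g i}"] assms by force
  then show ?thesis
    using assms by (auto simp: nbhd_def)
qed

lemma dens_mono:
  assumes "finite I" "finite V" "A \<subseteq> B" "B \<subseteq> I \<rightarrow>\<^sub>E V"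
  shows "dens I V A \<le> dens I V B"
proof -
  have "finite B"
    using assms finite_subset[OF assms(4)] by (simp add: finite_PiE)
  then show ?thesis
    using assms unfolding dens_def by (intro divide_right_mono) (auto intro: card_mono)
qed

lemma dens_all:
  assumes "finite I" "finite V" "V \<noteq> {}"
  shows "dens I V (I \<rightarrow>\<^sub>E V) = 1"
  using assms by (simp add: dens_def card_PiE)

text \<open>Inserting the value at \<open>i\<close> is a bijection from the disjoint union of the
  slices onto \<open>A\<close>; it is injective because functions in a slice are
  \<open>undefined\<close> at \<open>i\<close>.\<close>

lemma dens_slices:
  assumes "finite I" "i \<notin> I" "finite V" "A \<subseteq> insert i I \<rightarrow>\<^sub>E V"
  shows "dens (insert i I) V A = (\<Sum>v\<in>V. dens I V (slice I V i A v)) / card V"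
proof -
  let ?F = "\<lambda>(v, f). f(i := v)"
  have "bij_betw ?F (SIGMA v:V. slice I V i A v) A"
    unfolding bij_betw_def
  proof
    show "inj_on ?F (SIGMA v:V. slice I V i A v)"
    proof (rule inj_onI, clarify)
      fix v f w g
      assume "f \<in> slice I V i A v" "g \<in> slice I V i A w" and eq: "f(i := v) = g(i := w)"
      then have "f i = undefined" "g i = undefined"
        using assms(2) by (auto simp: slice_def PiE_def extensional_def)
      then show "v = w \<and> f = g"
        using eq by (metis fun_upd_same fun_upd_triv fun_upd_upd)
    qed
    show "?F ` (SIGMA v:V. slice I V i A v) = A"
    proof
      show "A \<subseteq> ?F ` (SIGMA v:V. slice I V i A v)"
      proof
        fix g assume g: "g \<in> A"
        then have "g \<in> insert i I \<rightarrow>\<^sub>E V" using assms by auto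
        then have "g i \<in> V" "g(i := undefined) \<in> I \<rightarrow>\<^sub>E V"
          using assms(2) by (auto simp: PiE_def extensional_def Pi_def)
        then show "g \<in> ?F ` (SIGMA v:V. slice I V i A v)"
          using g by (intro image_eqI[of _ _ "(g i, g(i := undefined))"]) (auto simp: slice_def)
      qed
    qed (auto simp: slice_def)
  qed
  then have "card A = card (SIGMA v:V. slice I V i A v)"
    by (simp add: bij_betw_same_card)
  also have "\<dots> = (\<Sum>v\<in>V. card (slice I V i A v))"
    using assms by (intro card_SigmaI) (auto simp: slice_def finite_PiE)
  finally show ?thesis
    using assms by (simp add: dens_def sum_divide_distrib mult.commute)
qed

text \<open>Giving both functions the same value at \<open>i\<close> leaves their Hamming distance
  unchanged.\<close>

lemma nbhd_slice:
  assumes "finite I" "i \<notin> I" "v \<in> V"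
  shows "nbhd I V t (slice I V i A v) \<subseteq> slice I V i (nbhd (insert i I) V t A) v"
proof
  fix g assume g: "g \<in> nbhd I V t (slice I V i A v)"
  then obtain f where f: "f \<in> slice I V i A v" "card {j \<in> I. f j \<noteq> g j} \<le> t" and gI: "g \<in> I \<rightarrow>\<^sub>E V"
    by (auto simp: nbhd_def)
  have "{j \<in> insert i I. (f(i := v)) j \<noteq> (g(i := v)) j} = {j \<in> I. f j \<noteq> g j}"
    using assms by auto
  then have "card {j \<in> insert i I. (f(i := v)) j \<noteq> (g(i := v)) j} \<le> t"
    using f by (simp only:)
  moreover have "f(i := v) \<in> A" "g(i := v) \<in> insert i I \<rightarrow>\<^sub>E V"
    using f PiE_fun_upd[of v "\<lambda>_. V" i g I] gI assms by (simp_all add: slice_def)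
  ultimately have "g(i := v) \<in> nbhd (insert i I) V t A"
    by (intro nbhdI)
  then show "g \<in> slice I V i (nbhd (insert i I) V t A) v"
    using gI by (simp add: slice_def)
qed

text \<open>Moving from slice \<open>w\<close> to slice \<open>v\<close> costs at most one change,
  leaving \<open>t - 1\<close> changes inside the slice.\<close>

lemma nbhd_slice_other:
  assumes "finite I" "i \<notin> I" "v \<in> V" "1 \<le> t"
  shows "nbhd I V (t - 1) (slice I V i A w) \<subseteq> slice I V i (nbhd (insert i I) V t A) v"
proof
  fix g assume g: "g \<in> nbhd I V (t - 1) (slice I V i A w)"
  then obtain f where f: "f \<in> slice I V i A w" "card {j \<in> I. f j \<noteq> g j} \<le> t - 1" and gI: "g \<in> I \<rightarrow>\<^sub>E V"
    by (auto simp: nbhd_def)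
  have "card {j \<in> insert i I. (f(i := w)) j \<noteq> (g(i := v)) j} \<le> card (insert i {j \<in> I. f j \<noteq> g j})"
    using assms by (intro card_mono) auto
  also have "\<dots> \<le> t"
    using f assms by (simp add: card_insert_if)
  finally have "card {j \<in> insert i I. (f(i := w)) j \<noteq> (g(i := v)) j} \<le> t" .
  moreover have "f(i := w) \<in> A" "g(i := v) \<in> insert i I \<rightarrow>\<^sub>E V"
    using f PiE_fun_upd[of v "\<lambda>_. V" i g I] gI assms by (simp_all add: slice_def)
  ultimately have "g(i := v) \<in> nbhd (insert i I) V t A"
    by (intro nbhdI)
  then show "g \<in> slice I V i (nbhd (insert i I) V t A) v"
    using gI by (simp add: slice_def)
qed

text \<open>The induction varies \<open>A\<close>, \<open>x\<close> and \<open>t\<close>, since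
  slices have different densities and the largest one is used with \<open>t - 1\<close>. The
  inequality in the hypothesis also admits sets of density 1, which no value of \<open>Phi\<close>
  attains.\<close>

theorem hamming_isoperimetry:
  assumes "finite I" and V: "finite V" "V \<noteq> {}"
    and "A \<subseteq> I \<rightarrow>\<^sub>E V" "Phi x \<le> dens I V A"
  shows "Phi (x + gain (card I) t) \<le> dens I V (nbhd I V t A)"
  using assms(1,4,5)
proof (induction I arbitrary: A x t rule: finite_induct)
  case empty
  have "A \<noteq> {}"
    using empty.prems Phi_pos[of x] by (auto simp: dens_def)
  then have "nbhd {} V t A = {} \<rightarrow>\<^sub>E V"
    by (intro nbhd_eq_all) auto
  then show ?case
    using dens_all[of "{}" V] V Phi_less_1 by (metis finite.emptyI less_imp_le)
next
  case (insert i I)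
  let ?J = "insert i I"
  let ?N = "card I"
  have finJ: "finite ?J" using insert.hyps by simp
  have cJ: "card ?J = Suc ?N" using insert.hyps by simp
  have "A \<noteq> {}"
    using insert.prems Phi_pos[of x] by (auto simp: dens_def)
  consider "t = 0" | "Suc ?N \<le> t" | "1 \<le> t" "t \<le> ?N" by linarith
  then show ?case
  proof cases
    case 1
    have "dens ?J V A \<le> dens ?J V (nbhd ?J V t A)"
      using finJ V insert.prems by (intro dens_mono subset_nbhd nbhd_subset)
    then show ?thesis
      using insert.prems 1 by (simp add: gain_def)
  next
    case 2
    then have "nbhd ?J V t A = ?J \<rightarrow>\<^sub>E V"
      using finJ cJ \<open>A \<noteq> {}\<close> by (intro nbhd_eq_all) auto
    then show ?thesis
      using dens_all[OF finJ V] Phi_less_1 by (simp add: less_imp_le)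
  next
    case 3
    define a where "a v = dens I V (slice I V i A v)" for v
    define b where "b v = dens I V (slice I V i (nbhd ?J V t A) v)" for v
    have sl: "slice I V i B v \<subseteq> I \<rightarrow>\<^sub>E V" for B v
      by (auto simp: slice_def)
    have avg_a: "dens ?J V A = sum a V / card V"
      unfolding a_def using insert.hyps insert.prems V by (intro dens_slices)
    have avg_b: "dens ?J V (nbhd ?J V t A) = sum b V / card V"
      unfolding b_def using insert.hyps V by (intro dens_slices nbhd_subset)
    have b1: "Phi (u + gain ?N t) \<le> b v" if v: "v \<in> V" "Phi u \<le> a v" for u v
    proof -
      have "Phi (u + gain ?N t) \<le> dens I V (nbhd I V t (slice I V i A v))"
        using v(2) unfolding a_def by (intro insert.IH sl)
      also have "\<dots> \<le> b v"
        unfolding b_def using insert.hyps V v by (intro dens_mono nbhd_slice sl) auto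
      finally show ?thesis .
    qed
    have b2: "dens I V (nbhd I V (t - 1) (slice I V i A w)) \<le> b v" if "v \<in> V" for v w
      unfolding b_def using insert.hyps V that 3 by (intro dens_mono nbhd_slice_other sl) auto
    have "Max (a ` V) \<in> a ` V"
      using V by (intro Max_in) auto
    then obtain w where w: "w \<in> V" "a w = Max (a ` V)" by auto
    have aw: "a v \<le> a w" if "v \<in> V" for v
      using w V that by simp
    have cV: "0 < real (card V)" using V by (simp add: card_gt_0_iff)
    have "sum a V / card V \<le> a w"
      using sum_mono[of V a "\<lambda>_. a w"] aw cV by (simp add: field_simps)
    then have "Phi x \<le> a w"
      using insert.prems avg_a by linarith
    then have "0 < a w" using Phi_pos[of x] by linarith
    show ?thesis
    proof (cases "a w < 1")
      case True
      with \<open>0 < a w\<close> obtain y where y: "Phi y = a w" by (rule Phi_surj)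
      \<comment> \<open>With this choice \<open>y - D + gain ?N t\<close> equals
        \<open>y + gain ?N (t - 1)\<close>, the level reached from the largest slice with
        \<open>t - 1\<close> changes.\<close>
      define D where "D = gain ?N t - gain ?N (t - 1)"
      note rec = gain_recursion[OF 3 D_def]
      show ?thesis
        unfolding cJ avg_b
      proof (rule Phi_average_shift[OF V rec(1) _ rec(2,3)])
        show "0 < gain ?N t"
          using 3 by (intro gain_pos) auto
        show "Phi (y - D + gain ?N t) \<le> b v" if "v \<in> V" for v
        proof -
          have "Phi (y + gain ?N (t - 1)) \<le> dens I V (nbhd I V (t - 1) (slice I V i A w))"
            using y unfolding a_def by (intro insert.IH sl) simp
          then show ?thesis
            using b2[OF that, of w] by (simp add: D_def)
        qed
      qed (use aw y b1 insert.prems avg_a in auto)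
    next
      \<comment> \<open>The largest slice is then full, so every slice of the neighbourhood is full
        as well.\<close>
      case False
      have "slice I V i A w = I \<rightarrow>\<^sub>E V"
      proof (rule card_subset_eq)
        show "finite (I \<rightarrow>\<^sub>E V)" using insert.hyps V by (simp add: finite_PiE)
        then have "card (slice I V i A w) \<le> card (I \<rightarrow>\<^sub>E V)"
          using sl by (rule card_mono)
        moreover have "real (card V) ^ ?N \<le> real (card (slice I V i A w))"
          using False cV by (simp add: a_def dens_def field_simps)
        moreover have "card (I \<rightarrow>\<^sub>E V) = card V ^ ?N"
          using insert.hyps by (simp add: card_PiE)
        ultimately show "card (slice I V i A w) = card (I \<rightarrow>\<^sub>E V)"
          by (metis of_nat_le_iff of_nat_power order_antisym)
      qed (rule sl)
      then have "dens I V (nbhd I V (t - 1) (slice I V i A w)) = 1"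
        using dens_mono[OF insert.hyps(1) V(1) subset_nbhd nbhd_subset, of "slice I V i A w" "t - 1"]
          dens_mono[OF insert.hyps(1) V(1) nbhd_subset order_refl, of "t - 1" "slice I V i A w"]
          dens_all[OF insert.hyps(1) V] by auto
      then have "(\<Sum>v\<in>V. 1) \<le> sum b V"
        using b2[of _ w] by (intro sum_mono) auto
      then have "1 \<le> sum b V / card V"
        using cV by (simp add: field_simps)
      then show ?thesis
        unfolding avg_b using Phi_less_1 less_imp_le order_trans by blast
    qed
  qed
qed

section \<open>Robustness of classes\<close>

text \<open>Pixel values lie in the unit interval, so each differing entry contributes at most 1 to
  the sum of \<open>p\<close>th powers.\<close>

lemma tensor_norm_le_hamming:
  assumes "I \<in> images n h b" "J \<in> images n h b"
    and card: "card {i \<in> tensor_index n h. I i \<noteq> J i} \<le> t" and d: "real t \<le> d"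
  shows "tensor_norm n h p (\<lambda>i. I i - J i) \<le> d powr (1 / real (max p 1))"
proof (cases "p = 0")
  case True
  then show ?thesis
    using card d by (simp add: tensor_norm_def)
next
  case False
  let ?T = "tensor_index n h"
  have pixel: "0 \<le> z \<and> z \<le> 1" if z: "z \<in> pixel_values b" for z
  proof -
    obtain x where x: "z = real x / (2 ^ b - 1)" "x \<le> 2 ^ b - 1"
      using z by (auto simp: pixel_values_def)
    have "real x \<le> real (2 ^ b - 1)" using x(2) by (rule of_nat_mono)
    also have "\<dots> = 2 ^ b - 1" by (simp add: of_nat_diff)
    \<comment> \<open>For \<open>b = 0\<close> the denominator vanishes and the quotient is 0 by
      convention.\<close>
    finally show ?thesis
      by (cases "(2::real) ^ b - 1 = 0") (auto simp: x divide_simps)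
  qed
  have diff: "\<bar>I i - J i\<bar> ^ p \<le> (if I i \<noteq> J i then 1 else 0)" if "i \<in> ?T" for i
  proof -
    have "I i \<in> pixel_values b" "J i \<in> pixel_values b"
      using assms that by (auto simp: images_def)
    then have "\<bar>I i - J i\<bar> \<le> 1"
      using pixel[of "I i"] pixel[of "J i"] by auto
    then show ?thesis
      using False by (auto simp: zero_power intro: power_le_one)
  qed
  have "(\<Sum>i\<in>?T. \<bar>I i - J i\<bar> ^ p) \<le> (\<Sum>i\<in>?T. if I i \<noteq> J i then 1 else 0)"
    by (intro sum_mono diff)
  also have "\<dots> = real (card {i \<in> ?T. I i \<noteq> J i})"
    by (simp add: finite_tensor_index flip: sum.inter_filter)
  also have "\<dots> \<le> d"
    using card d by linarith
  finally have "root p (\<Sum>i\<in>?T. \<bar>I i - J i\<bar> ^ p) \<le> root p d"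
    using False by simp
  also have "root p d = d powr (1 / real (max p 1))"
  proof -
    have "max p 1 = p" using False by simp
    then show ?thesis
      using False d by (cases "d = 0") (auto simp: root_powr_inverse)
  qed
  finally show ?thesis
    using False by (simp add: tensor_norm_def)
qed

theorem theorem1:
  fixes n h b p :: nat and Y :: "'y set" and f :: "tensor \<Rightarrow> 'y" and c :: real
    and C :: "tensor set"
  assumes "n \<ge> 1" and "h \<ge> 1" and "b \<ge> 1"
    and "finite Y" and "f \<in> images n h b \<rightarrow> Y"
    and "c > 0"
    and "C \<in> induced_class n h b f ` Y" and "interesting n h b C"
  shows "\<not> robust_class n h b f (2 * exp (- 2 * c\<^sup>2)) p
            ((2 + c * sqrt (real h) * real n) powr (1 / real (max p 1))) C"
proof
  let ?T = "tensor_index n h" and ?V = "pixel_values b"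
  define N where "N = n * n * h"
  define d where "d = 2 + c * sqrt (real h) * real n"
  define t where "t = nat \<lfloor>d\<rfloor>"
  define S where "S = {I \<in> C. robust_image n h b f p (d powr (1 / real (max p 1))) I}"
  assume "robust_class n h b f (2 * exp (- 2 * c\<^sup>2)) p
            ((2 + c * sqrt (real h) * real n) powr (1 / real (max p 1))) C"
  then have robust: "2 * exp (- 2 * c\<^sup>2) * real (card C) \<le> real (card S)"
    by (simp add: robust_class_def S_def d_def)
  obtain y where C: "C = induced_class n h b f y"
    using assms(7) by auto
  have CI: "C \<subseteq> images n h b" and SC: "S \<subseteq> C"
    by (auto simp: C induced_class_def S_def)
  have "finite C" "C \<noteq> {}"
    using finite_subset[OF CI finite_images] assms(8) by (simp_all add: interesting_def)
  then have cC: "0 < real (card C)"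
    by (simp add: card_gt_0_iff)
  have V: "finite ?V" "?V \<noteq> {}"
    by (auto simp: pixel_values_image)
  have cT: "card ?T = N"
    by (simp add: tensor_index_def N_def)
  have dens: "dens ?T ?V A = real (card A) / real (card (images n h b))" for A
    using finite_tensor_index by (simp add: dens_def images_def card_PiE)
  have cI: "0 < real (card (images n h b))"
    using CI \<open>C \<noteq> {}\<close> finite_images by (auto simp: card_gt_0_iff)
  have sqrtN: "sqrt (real N) = sqrt (real h) * real n"
    by (simp add: N_def real_sqrt_mult)
  have "1 \<le> N" using assms(1,2) by (simp add: N_def)
  have "2 \<le> d" using assms(6) by (simp add: d_def)
  then have t: "real t \<le> d" "d < real t + 1" "1 \<le> t"
    unfolding t_def by linarith+
  have "nbhd ?T ?V t S \<subseteq> C"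
  proof
    fix J assume "J \<in> nbhd ?T ?V t S"
    then obtain I where I: "I \<in> S" "card {i \<in> ?T. I i \<noteq> J i} \<le> t" and J: "J \<in> images n h b"
      by (auto simp: nbhd_def images_def)
    then have "tensor_norm n h p (\<lambda>i. I i - J i) \<le> d powr (1 / real (max p 1))"
      using SC CI t by (intro tensor_norm_le_hamming) auto
    then have "f I = f J"
      using I J by (simp add: S_def robust_image_def)
    then show "J \<in> C"
      using I SC J by (auto simp: C induced_class_def)
  qed
  then have nbhd_C: "dens ?T ?V (nbhd ?T ?V t S) \<le> dens ?T ?V C"
    using CI V finite_tensor_index by (intro dens_mono) (auto simp: images_def)
  have half: "dens ?T ?V C \<le> 1 / 2"
    using assms(8) cI by (simp add: dens interesting_def field_simps)
  have pos: "0 < dens ?T ?V C"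
    using cC cI by (simp add: dens)
  have dens_S: "2 * exp (- 2 * c\<^sup>2) * dens ?T ?V C \<le> dens ?T ?V S"
    using robust cI by (simp add: dens divide_right_mono)
  then have "0 < dens ?T ?V S"
    using pos by (smt (verit) exp_gt_zero mult_pos_pos)
  moreover have "dens ?T ?V S \<le> dens ?T ?V C"
    using SC CI V finite_tensor_index by (intro dens_mono) (auto simp: images_def)
  ultimately obtain x where x: "Phi x = dens ?T ?V S"
    using half by (auto intro: Phi_surj[of "dens ?T ?V S"])
  define s where "s = gain N t"
  have "Phi (x + s) \<le> dens ?T ?V (nbhd ?T ?V t S)"
    unfolding s_def cT[symmetric] using SC CI x V finite_tensor_index
    by (intro hamming_isoperimetry) (auto simp: images_def)
  then have xs: "Phi (x + s) \<le> dens ?T ?V C"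
    using nbhd_C by (rule order_trans)
  then have "Phi (x + s) \<le> Phi 0"
    using half unfolding Phi_0 by (rule order_trans)
  then have "x + s \<le> 0" by simp
  \<comment> \<open>The 2 in the perturbation size pays for rounding \<open>d\<close> down to
    \<open>t\<close> and for the \<open>t - 1\<close> in \<open>gain\<close>.\<close>
  have "c * sqrt (real N) \<le> real t - 1"
    using t by (simp add: d_def sqrtN mult.assoc)
  then have "2 * c \<le> 2 * (real t - 1) / sqrt (real N)"
    using \<open>1 \<le> N\<close> by (simp add: field_simps)
  then have s: "2 * c \<le> s"
    using t by (simp add: s_def gain_def add_increasing2)
  have "dens ?T ?V S = Phi (x + s - s)"
    by (simp add: x)
  also have "\<dots> \<le> exp (- s\<^sup>2 / 2) * Phi (x + s)"
    using \<open>x + s \<le> 0\<close> s assms(6) by (intro Phi_shift_le) auto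
  \<comment> \<open>Since \<open>s \<ge> 2 * c\<close>, the exponent satisfies
    \<open>s\<^sup>2 / 2 \<ge> 2 * c\<^sup>2\<close>.\<close>
  also have "\<dots> \<le> exp (- 2 * c\<^sup>2) * dens ?T ?V C"
  proof (intro mult_mono xs)
    have "(2 * c)\<^sup>2 \<le> s\<^sup>2"
      using s assms(6) by (intro power_mono) auto
    then show "exp (- s\<^sup>2 / 2) \<le> exp (- 2 * c\<^sup>2)"
      by (simp add: power_mult_distrib)
  qed (use Phi_pos[of "x + s"] in auto)
  also have "\<dots> < 2 * exp (- 2 * c\<^sup>2) * dens ?T ?V C"
    using pos by simp
  finally show False
    using dens_S by simp
qed

end
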